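(* Let $n=1$ and let $p,q$ be real numbers. If either $q>2$ and $p+3<q\le 2\sqrt{\frac{5+p}{3}}$; or $p<-2$ and $-2\sqrt{\frac{5-q}{3}}\le p<q-3$, then the embedded solution to the planar isotropic $L_p$ dual Minkowski problem $$u^{1-p}r^{q-2}\,(u''+u)=1\quad\text{on }\mathbb{S}^1$$ is unique.
   Context: An embedded solution is a smooth closed embedded strictly convex curve $M\subset\mathbb{R}^2$ (with positive curvature) bounding a convex body that contains the origin in its interior, whose support function $u:\mathbb{S}^1\to(0,\infty)$ (a smooth positive $2\pi$-periodic function of the angle $\theta$ of the unit outer normal) satisfies the equation, where $'$ denotes $d/d\theta$ and $r=\sqrt{u^2+(u')^2}$ is the distance from the origin to the point of $M$ with that outer normal. *)

theory Defs
  imports "HOL-Analysis.Analysis"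
begin

definition smooth :: "(real \<Rightarrow> 'a::real_normed_vector) \<Rightarrow> bool" where
  "smooth f \<longleftrightarrow>
     (\<forall>k t. ((\<lambda>g s. vector_derivative g (at s)) ^^ k) f differentiable (at t))"

definition velocity :: "(real \<Rightarrow> real^2) \<Rightarrow> real \<Rightarrow> real^2" where
  "velocity c t = vector_derivative c (at t)"

text \<open>Signed curvature, positive for a convex curve traversed counterclockwise.\<close>

definition curvature :: "(real \<Rightarrow> real^2) \<Rightarrow> real \<Rightarrow> real" where
  "curvature c t =
     (velocity c t $ 1 * velocity (velocity c) t $ 2 - velocity c t $ 2 * velocity (velocity c) t $ 1)
       / norm (velocity c t) ^ 3"

text \<open>A smooth closed embedded curve of positive curvature, as a subset of the plane: the trace
  of a regular smooth \<open>2\<pi>\<close>-periodic parametrization that is injective on a period. Positivity of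
  the signed curvature fixes only the orientation of the parametrization, not the set.\<close>

definition smooth_closed_embedded_positively_curved :: "(real^2) set \<Rightarrow> bool" where
  "smooth_closed_embedded_positively_curved M \<longleftrightarrow>
     (\<exists>c. smooth c \<and> (\<forall>t. c (t + 2 * pi) = c t) \<and> inj_on c {0..<2 * pi} \<and> range c = M \<and>
          (\<forall>t. velocity c t \<noteq> 0) \<and> (\<forall>t. curvature c t > 0))"

definition strictly_convex :: "(real^2) set \<Rightarrow> bool" where
  "strictly_convex K \<longleftrightarrow>
     (\<forall>x\<in>K. \<forall>y\<in>K. x \<noteq> y \<longrightarrow> open_segment x y \<subseteq> interior K)"

definition unit_normal :: "real \<Rightarrow> real^2" where
  "unit_normal \<theta> = vector [cos \<theta>, sin \<theta>]"

definition support_function :: "(real^2) set \<Rightarrow> real \<Rightarrow> real" where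
  "support_function K \<theta> = (SUP x\<in>K. x \<bullet> unit_normal \<theta>)"

text \<open>The distance from the origin to the boundary point with outer normal angle \<open>\<theta>\<close>, that
  point being \<open>u \<theta> (cos \<theta>, sin \<theta>) + u' \<theta> (- sin \<theta>, cos \<theta>)\<close>.\<close>

definition radial_distance :: "(real \<Rightarrow> real) \<Rightarrow> real \<Rightarrow> real" where
  "radial_distance u \<theta> = sqrt ((u \<theta>)\<^sup>2 + (deriv u \<theta>)\<^sup>2)"

definition isotropic_Lp_dual_Minkowski :: "real \<Rightarrow> real \<Rightarrow> (real \<Rightarrow> real) \<Rightarrow> bool" where
  "isotropic_Lp_dual_Minkowski p q u \<longleftrightarrow>
     (\<forall>\<theta>. u \<theta> powr (1 - p) * radial_distance u \<theta> powr (q - 2)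
            * (deriv (deriv u) \<theta> + u \<theta>) = 1)"

definition embedded_solution :: "real \<Rightarrow> real \<Rightarrow> (real^2) set \<Rightarrow> bool" where
  "embedded_solution p q M \<longleftrightarrow>
     smooth_closed_embedded_positively_curved M \<and>
     (\<exists>K. compact K \<and> convex K \<and> strictly_convex K \<and> 0 \<in> interior K \<and> frontier K = M \<and>
          smooth (support_function K) \<and> (\<forall>\<theta>. support_function K \<theta> > 0) \<and>
          isotropic_Lp_dual_Minkowski p q (support_function K))"

end

theory Submission
  imports Defs
begin

text \<open>Put \<open>t = u' / u\<close> and \<open>z = u\<^sup>p / r\<^sup>q\<close>. The equation becomes the autonomous system
  \<open>t' = (z - 1) (1 + t\<^sup>2)\<close>, \<open>z' = z t (p - q z)\<close>, and every \<open>f = u\<^sup>k r\<^sup>c t\<close> satisfies \<open>f'' = Q f\<close>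
  with \<open>Q\<close> a polynomial in \<open>z\<close> and \<open>t\<^sup>2\<close>. Suitable exponents \<open>k, c\<close> give \<open>Q > -4\<close>, others give
  \<open>Q < -1\<close>; as \<open>f\<close> has the sign of \<open>u'\<close>, Sturm comparison shows that the nodal intervals of \<open>u'\<close>
  have lengths strictly between \<open>\<pi>/2\<close> and \<open>\<pi>\<close>. There would be exactly three of them on the
  circle, whereas their number is even. Hence \<open>u\<close> is constant, and the solution is the unit circle.\<close>

section \<open>Sturm comparison and consecutive zeros\<close>

text \<open>The Wronskian \<open>W\<close> of \<open>f\<close> and the sine of frequency
  \<open>\<omega>\<close> vanishing at \<open>a\<close> increases as long as that sine is positive.
  On an interval of length at most pi / \<open>\<omega>\<close> this would make \<open>f' b\<close>
  positive, impossible where a positive function falls to zero.\<close>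

lemma sturm_length_gt:
  fixes f f' f'' :: "real \<Rightarrow> real"
  assumes "a < b" and \<omega>: "\<omega> > 0"
    and df: "\<And>x. (f has_real_derivative f' x) (at x)"
    and df': "\<And>x. (f' has_real_derivative f'' x) (at x)"
    and ends: "f a = 0" "f b = 0"
    and pos: "\<And>x. a < x \<Longrightarrow> x < b \<Longrightarrow> f x > 0"
    and ineq: "\<And>x. a < x \<Longrightarrow> x < b \<Longrightarrow> f'' x + \<omega>\<^sup>2 * f x > 0"
  shows "\<omega> * (b - a) > pi"
proof (rule ccontr)
  assume "\<not> ?thesis"
  then have len: "\<omega> * (b - a) \<le> pi" by simp
  define W where "W x = f' x * sin (\<omega> * (x - a)) - \<omega> * f x * cos (\<omega> * (x - a))" for x
  have dW: "(W has_real_derivative sin (\<omega> * (x - a)) * (f'' x + \<omega>\<^sup>2 * f x)) (at x)" for x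
    unfolding W_def
    by (auto intro!: derivative_eq_intros df df' simp: algebra_simps power2_eq_square)
  have "W a < W b"
  proof (rule DERIV_pos_imp_increasing_open[OF \<open>a < b\<close>])
    fix x assume x: "a < x" "x < b"
    have "\<omega> * (x - a) < \<omega> * (b - a)" using x \<omega> by simp
    then have "\<omega> * (x - a) < pi" using len by linarith
    then have "sin (\<omega> * (x - a)) > 0" using x \<omega> by (intro sin_gt_zero) auto
    then show "\<exists>y. (W has_real_derivative y) (at x) \<and> y > 0"
      using dW[of x] ineq[OF x] by (intro exI[of _ "sin (\<omega> * (x - a)) * (f'' x + \<omega>\<^sup>2 * f x)"]) simp
  next
    show "continuous_on {a..b} W"
      using dW by (meson DERIV_isCont continuous_at_imp_continuous_on)
  qed
  moreover have "W a = 0" "W b = f' b * sin (\<omega> * (b - a))" by (simp_all add: W_def ends)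
  moreover have "sin (\<omega> * (b - a)) \<ge> 0" using len \<open>a < b\<close> \<omega> by (intro sin_ge_zero) auto
  ultimately have "f' b > 0" by (simp add: zero_less_mult_iff)
  then obtain d where d: "d > 0" "\<And>h. h > 0 \<Longrightarrow> h < d \<Longrightarrow> f (b - h) < f b"
    using DERIV_pos_inc_left[OF df] by blast
  define h where "h = min (d / 2) ((b - a) / 2)"
  have "h > 0" "h < d" "a < b - h" "b - h < b"
    using d(1) \<open>a < b\<close> by (auto simp: h_def min_def field_simps)
  then show False using d(2)[of h] pos[of "b - h"] ends by simp
qed

lemma sturm_length_lt:
  fixes f f' f'' :: "real \<Rightarrow> real"
  assumes \<omega>: "\<omega> > 0"
    and df: "\<And>x. (f has_real_derivative f' x) (at x)"
    and df': "\<And>x. (f' has_real_derivative f'' x) (at x)"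
    and ends: "f a = 0" "f b = 0"
    and pos: "\<And>x. a < x \<Longrightarrow> x < b \<Longrightarrow> f x > 0"
    and ineq: "\<And>x. a < x \<Longrightarrow> x < b \<Longrightarrow> f'' x + \<omega>\<^sup>2 * f x < 0"
  shows "\<omega> * (b - a) < pi"
proof (rule ccontr)
  assume "\<not> ?thesis"
  then have len: "\<omega> * (b - a) \<ge> pi" by simp
  \<comment> \<open>The next zero of the comparison sine. Its cosine there is -1, so
    \<open>W e\<close> is \<open>\<omega> * f e\<close>, and the decrease of \<open>W\<close> forces
    \<open>f e\<close> below zero although \<open>e\<close> lies in the nodal interval or at its
    end.\<close>
  define e where "e = a + pi / \<omega>"
  have ae: "a < e" using \<omega> by (simp add: e_def)
  have eb: "e \<le> b" using len \<omega> by (simp add: e_def field_simps)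
  define W where "W x = f' x * sin (\<omega> * (x - a)) - \<omega> * f x * cos (\<omega> * (x - a))" for x
  have dW: "(W has_real_derivative sin (\<omega> * (x - a)) * (f'' x + \<omega>\<^sup>2 * f x)) (at x)" for x
    unfolding W_def
    by (auto intro!: derivative_eq_intros df df' simp: algebra_simps power2_eq_square)
  have "W a > W e"
  proof (rule DERIV_neg_imp_decreasing_open[OF ae])
    fix x assume x: "a < x" "x < e"
    have "\<omega> * (x - a) < \<omega> * (e - a)" using x \<omega> by simp
    also have "\<dots> = pi" using \<omega> by (simp add: e_def)
    finally have "sin (\<omega> * (x - a)) > 0" using x \<omega> by (intro sin_gt_zero) auto
    then show "\<exists>y. (W has_real_derivative y) (at x) \<and> y < 0"
      using dW[of x] ineq[of x] x eb
      by (intro exI[of _ "sin (\<omega> * (x - a)) * (f'' x + \<omega>\<^sup>2 * f x)"]) (simp add: mult_pos_neg)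
  next
    show "continuous_on {a..e} W"
      using dW by (meson DERIV_isCont continuous_at_imp_continuous_on)
  qed
  moreover have "W a = 0" "W e = \<omega> * f e" using \<omega> by (simp_all add: W_def ends e_def)
  ultimately have "f e < 0" using \<omega> by (simp add: mult_less_0_iff)
  then show False using pos[of e] ae eb ends by (cases "e = b") auto
qed

text \<open>As \<open>f\<close> is positive just after \<open>a\<close>, its later zeros stay away
  from \<open>a\<close> and form a closed set, whose infimum is the required \<open>b\<close>; the
  zero \<open>w\<close> makes this set nonempty. Simplicity of the zeros gives the strict sign of
  \<open>f' b\<close>.\<close>

lemma next_zero:
  fixes f f' :: "real \<Rightarrow> real"
  assumes df: "\<And>x. (f has_real_derivative f' x) (at x)"
    and simple: "\<And>x. f x = 0 \<Longrightarrow> f' x \<noteq> 0"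
    and a: "f a = 0" "f' a > 0"
    and w: "a < w" "f w = 0"
  obtains b where "a < b" "f b = 0" "f' b < 0" "\<And>x. a < x \<Longrightarrow> x < b \<Longrightarrow> f x > 0"
    "\<And>x. a < x \<Longrightarrow> f x = 0 \<Longrightarrow> b \<le> x"
proof -
  have cont: "continuous_on S f" for S
    using df by (meson DERIV_isCont continuous_at_imp_continuous_on)
  obtain d where d: "d > 0" "\<And>h. h > 0 \<Longrightarrow> h < d \<Longrightarrow> f (a + h) > 0"
    using DERIV_pos_inc_right[OF df a(2)] a(1) by metis
  have near: "f x > 0" if "a < x" "x < a + d" for x
    using d(2)[of "x - a"] that by simp
  \<comment> \<open>Starting at \<open>a + d / 2\<close> keeps the set closed and excludes
    \<open>a\<close>, yet loses no later zero.\<close>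
  define S where "S = {a + d / 2..} \<inter> f -` {0}"
  have zS: "x \<in> S" if "a < x" "f x = 0" for x
    using near[of x] that d(1) by (force simp: S_def)
  have "closed S" unfolding S_def by (intro continuous_closed_preimage cont) auto
  moreover have "S \<noteq> {}" using zS w by auto
  moreover have bb: "bdd_below S" unfolding S_def by (rule bdd_belowI[of _ "a + d / 2"]) auto
  ultimately have bS: "Inf S \<in> S" by (intro closed_contains_Inf)
  define b where "b = Inf S"
  have b: "a < b" "f b = 0" using bS d(1) by (auto simp: b_def S_def)
  have least: "b \<le> x" if "a < x" "f x = 0" for x
    unfolding b_def using zS[OF that] bb by (rule cInf_lower)
  have pos: "f x > 0" if x: "a < x" "x < b" for x
  proof (rule ccontr)
    assume "\<not> f x > 0"
    define e where "e = min (a + d / 2) x"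
    have e: "a < e" "e < a + d" "e \<le> x" using d(1) x by (auto simp: e_def)
    obtain \<xi> where "e \<le> \<xi>" "\<xi> \<le> x" "f \<xi> = 0"
      using IVT2'[of f x 0 e] near[OF e(1,2)] \<open>\<not> f x > 0\<close> e(3) cont by auto
    then show False using least[of \<xi>] e(1) x by simp
  qed
  have "\<not> f' b > 0"
  proof
    assume "f' b > 0"
    then obtain d' where d': "d' > 0" "\<And>h. h > 0 \<Longrightarrow> h < d' \<Longrightarrow> f (b - h) < f b"
      using DERIV_pos_inc_left[OF df] by blast
    define h where "h = min (d' / 2) ((b - a) / 2)"
    have "h > 0" "h < d'" "a < b - h" "b - h < b"
      using d'(1) b(1) by (auto simp: h_def min_def field_simps)
    then show False using d'(2)[of h] pos[of "b - h"] b(2) by simp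
  qed
  then have "f' b < 0" using simple[OF b(2)] by linarith
  with b pos least show thesis by (intro that)
qed

section \<open>The equation as an autonomous system\<close>

text \<open>Here \<open>y\<close> is u', and the equation is solved for u''. The signs of
  \<open>p\<close> and \<open>q\<close> are common to both parameter ranges.\<close>

locale periodic_solution =
  fixes p q :: real and u y :: "real \<Rightarrow> real"
  assumes p_neg: "p < 0" and q_pos: "q > 0"
    and u_pos: "u x > 0"
    and du: "(u has_real_derivative y x) (at x)"
    and dy: "(y has_real_derivative
               u x powr (p - 1) * sqrt ((u x)\<^sup>2 + (y x)\<^sup>2) powr (2 - q) - u x) (at x)"
    and periodic: "u (x + 2 * pi) = u x"
begin

definition r where "r x = sqrt ((u x)\<^sup>2 + (y x)\<^sup>2)"
definition t where "t x = y x / u x"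
definition z where "z x = u x powr p * r x powr (- q)"
definition y' where "y' x = u x * ((1 + (t x)\<^sup>2) * z x - 1)"

lemma r_pos: "r x > 0"
  using u_pos[of x] by (simp add: r_def sum_power2_gt_zero_iff)

lemma z_pos: "z x > 0"
  using u_pos[of x] r_pos[of x] by (simp add: z_def)

lemma r_sq: "(r x)\<^sup>2 = (u x)\<^sup>2 * (1 + (t x)\<^sup>2)"
  using u_pos[of x] by (simp add: r_def t_def field_simps)

text \<open>The radius of curvature u'' + u equals r^2 z / u, and r^2 = u^2 (1 + t^2); thus
  \<open>z\<close> absorbs all the real powers.\<close>

lemma dy': "(y has_real_derivative y' x) (at x)"
proof -
  have "u x powr (p - 1) * r x powr (2 - q) = u x powr p / u x * ((r x)\<^sup>2 * r x powr (- q))"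
    using u_pos[of x] r_pos[of x] powr_add[of "r x" 2 "- q"] by (simp add: powr_diff)
  also have "\<dots> = (r x)\<^sup>2 * z x / u x"
    by (simp add: z_def)
  also have "\<dots> = u x * (1 + (t x)\<^sup>2) * z x"
    using u_pos[of x] unfolding r_sq by (simp add: power2_eq_square)
  finally have "u x powr (p - 1) * r x powr (2 - q) - u x = y' x"
    by (simp add: y'_def algebra_simps)
  with dy[of x] show ?thesis by (simp add: r_def)
qed

lemma dt: "(t has_real_derivative (z x - 1) * (1 + (t x)\<^sup>2)) (at x)"
  unfolding t_def using u_pos[of x]
  by (auto intro!: derivative_eq_intros du dy' simp: y'_def t_def power2_eq_square field_simps)

text \<open>Since r r' = u' (u + u''), the logarithmic derivative of \<open>r\<close> is t z. That
  of \<open>u\<close> is t, so every product of powers of the two has logarithmic derivative t times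
  a linear function of \<open>z\<close>.\<close>

lemma dr: "(r has_real_derivative r x * (t x * z x)) (at x)"
proof -
  have "(r has_real_derivative (2 * u x * y x + 2 * y x * y' x) * (inverse (r x) / 2)) (at x)"
    unfolding r_def using r_pos[of x, unfolded r_def]
    by (auto intro!: derivative_eq_intros du dy')
  moreover have "(2 * u x * y x + 2 * y x * y' x) * (inverse (r x) / 2)
                 = ((u x)\<^sup>2 * (1 + (t x)\<^sup>2)) * (t x * z x) / r x"
    using u_pos[of x] r_pos[of x] by (simp add: y'_def t_def power2_eq_square field_simps)
  moreover have "\<dots> = r x * (t x * z x)"
    unfolding r_sq[symmetric] using r_pos[of x] by (simp add: power2_eq_square)
  ultimately show ?thesis by simp
qed

lemma d_u_powr: "((\<lambda>x. u x powr k) has_real_derivative u x powr k * (k * t x)) (at x)"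
  using DERIV_powr[OF du[of x] u_pos DERIV_const[of k]] u_pos[of x] by (simp add: t_def mult_ac)

lemma d_r_powr: "((\<lambda>x. r x powr k) has_real_derivative r x powr k * (k * t x * z x)) (at x)"
  using DERIV_powr[OF dr[of x] r_pos DERIV_const[of k]] r_pos[of x] by (simp add: mult_ac)

lemma dz: "(z has_real_derivative z x * t x * (p - q * z x)) (at x)"
  unfolding z_def
  by (rule derivative_eq_intros d_u_powr d_r_powr refl)+ (simp add: z_def algebra_simps)

definition weight where "weight k c x = u x powr k * r x powr c"

lemma weight_pos: "weight k c x > 0"
  using u_pos[of x] r_pos[of x] by (simp add: weight_def)

lemma d_weight: "(weight k c has_real_derivative weight k c x * (t x * (k + c * z x))) (at x)"
  unfolding weight_def
  by (rule derivative_eq_intros d_u_powr d_r_powr refl)+ (simp add: algebra_simps)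

definition f where "f k c x = weight k c x * t x"

definition f' where
  "f' k c x = weight k c x * ((t x)\<^sup>2 * (k + c * z x) + (z x - 1) * (1 + (t x)\<^sup>2))"

definition Q where
  "Q k c x = (k + c * z x) * ((t x)\<^sup>2 * (k + c * z x) + 3 * (z x - 1) * (1 + (t x)\<^sup>2))
     + c * z x * (p - q * z x) * (t x)\<^sup>2 + z x * (p - q * z x) * (1 + (t x)\<^sup>2)
     + 2 * (z x - 1)\<^sup>2 * (1 + (t x)\<^sup>2)"

lemma df: "(f k c has_real_derivative f' k c x) (at x)"
  unfolding f_def f'_def
  by (rule derivative_eq_intros d_weight dt refl)+ (simp add: algebra_simps power2_eq_square)

text \<open>Each term of the derivative of \<open>f'\<close> contains a factor \<open>t\<close>,
  because z' and (t^2)' do. Together with the weight this factor is \<open>f\<close>, so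
  \<open>Q\<close> is polynomial even where u' vanishes.\<close>

lemma df': "(f' k c has_real_derivative f k c x * Q k c x) (at x)"
  unfolding f'_def
  by (rule derivative_eq_intros d_weight dt dz refl)+
    (simp add: f_def Q_def algebra_simps power2_eq_square)

lemma f_sign: "\<sigma> * y x > 0 \<Longrightarrow> \<sigma> * f k c x > 0"
  using u_pos[of x] weight_pos[of k c x]
  by (auto simp: f_def t_def zero_less_mult_iff zero_less_divide_iff mult_less_0_iff divide_less_0_iff)

lemma f_zero: "y x = 0 \<Longrightarrow> f k c x = 0"
  by (simp add: f_def t_def)

text \<open>With \<open>k = 2\<close> the terms of \<open>Q + 4\<close> free of \<open>z\<close> cancel, and with \<open>k = 1\<close> those of \<open>Q + 1\<close>,
  so that only the signs of two linear polynomials in \<open>z\<close> matter.\<close>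

lemma Q_lower:
  assumes "0 \<le> 3 * c + 2 - q" "0 \<le> 2 - 3 * c + p" "q - p < 4"
    and "0 \<le> (c + 1) * (c + 2 - q)" "0 \<le> c + 2 + p * (c + 1)"
  shows "Q 2 c x + 4 > 0"
proof -
  have "Q 2 c x + 4 = z x * ((3 * c + 2 - q) * z x + (2 - 3 * c + p))
      + z x * ((c + 1) * (c + 2 - q) * z x + (c + 2 + p * (c + 1))) * (t x)\<^sup>2"
    by (simp add: Q_def algebra_simps power2_eq_square)
  moreover have "(3 * c + 2 - q) * z x + (2 - 3 * c + p) > 0"
  \<comment> \<open>If the slope vanishes, the constant term is 4 + p - q, positive by the strict
    third hypothesis.\<close>
  proof (cases "3 * c + 2 - q = 0")
    case False
    with assms(1) have "(3 * c + 2 - q) * z x > 0" using z_pos[of x] by simp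
    with assms(2) show ?thesis by linarith
  qed (use assms in simp)
  moreover have "(c + 1) * (c + 2 - q) * z x + (c + 2 + p * (c + 1)) \<ge> 0"
    using mult_nonneg_nonneg[OF assms(4), of "z x"] assms(5) z_pos[of x] by linarith
  ultimately show ?thesis
    using z_pos[of x] by (simp add: add_pos_nonneg)
qed

lemma Q_upper:
  assumes "3 * c + 2 - q \<le> 0" "p - 1 - 3 * c \<le> 0" "q - p > 1"
    and "(c + 1) * (c + 2 - q) \<le> 0" "0 \<le> c + 1"
  shows "Q 1 c x + 1 < 0"
proof -
  have "Q 1 c x + 1 = z x * ((3 * c + 2 - q) * z x + (p - 1 - 3 * c))
      + z x * ((c + 1) * (c + 2 - q) * z x + (c + 1) * (p - 1)) * (t x)\<^sup>2"
    by (simp add: Q_def algebra_simps power2_eq_square)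
  moreover have "(3 * c + 2 - q) * z x + (p - 1 - 3 * c) < 0"
  \<comment> \<open>If the slope vanishes, the constant term is 1 + p - q, again strictly signed by
    the third hypothesis.\<close>
  proof (cases "3 * c + 2 - q = 0")
    case False
    with assms(1) have "(3 * c + 2 - q) * z x < 0" using z_pos[of x] by (simp add: mult_neg_pos)
    with assms(2) show ?thesis by linarith
  qed (use assms in simp)
  moreover have "(c + 1) * (c + 2 - q) * z x + (c + 1) * (p - 1) \<le> 0"
    using mult_nonpos_nonneg[OF assms(4)] mult_nonneg_nonpos[OF assms(5)] z_pos[of x] p_neg
    by (intro add_nonpos_nonpos) (simp_all add: less_imp_le)
  ultimately show ?thesis
    using z_pos[of x] by (simp add: add_neg_nonpos mult_pos_neg mult_nonneg_nonpos mult_nonpos_nonneg)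
qed

section \<open>Conserved energy and the node count over a period\<close>

lemma y_periodic: "y (x + 2 * pi) = y x"
proof -
  have "((\<lambda>x. u (x + 2 * pi)) has_real_derivative y (x + 2 * pi)) (at x)"
    using du[of "x + 2 * pi"] by (simp add: DERIV_shift)
  then show ?thesis using du[of x] DERIV_unique by (simp add: periodic)
qed

text \<open>The energy \<open>r\<^sup>q / q - u\<^sup>p / p\<close> is conserved, and \<open>(u, u') = (1, 0)\<close> is its strict minimum.\<close>

lemma double_zero_imp_const:
  assumes "y x0 = 0" "y' x0 = 0"
  shows "u x = 1"
proof -
  define H where "H x = r x powr q / q - u x powr p / p" for x
  have "r x powr q * z x = u x powr p" for x
    using r_pos[of x] by (simp add: z_def powr_minus)
  then have "r x powr q * (q * t x * z x) / q - u x powr p * (p * t x) / p = 0" for x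
    using p_neg q_pos by (simp add: mult_ac)
  moreover have "(H has_real_derivative
      r x powr q * (q * t x * z x) / q - u x powr p * (p * t x) / p) (at x)" for x
    unfolding H_def by (intro DERIV_diff DERIV_cdivide d_r_powr d_u_powr)
  ultimately have "(H has_real_derivative 0) (at x)" for x by metis
  then have const: "H x = H x0" using DERIV_isconst_all by blast
  have t0: "t x0 = 0" using assms(1) by (simp add: t_def)
  then have "z x0 = 1" using assms(2) u_pos[of x0] by (simp add: y'_def)
  moreover have r0: "r x0 = u x0" using u_pos[of x0] assms(1) by (simp add: r_def)
  ultimately have "u x0 powr (p - q) = 1" by (simp add: z_def flip: powr_add)
  then have "(p - q) * ln (u x0) = 0" using u_pos[of x0] by (simp add: powr_def split: if_splits)
  then have "u x0 = 1" using p_neg q_pos u_pos[of x0] by simp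
  then have H0: "H x0 = 1 / q - 1 / p" using r0 by (simp add: H_def)
  define s where "s = ln (u x)"
  \<comment> \<open>This is exp(ks) >= 1 + ks. Used for \<open>p\<close> in the energy bound, it
    yields the reverse inequality for \<open>q\<close>; equality in the latter then forces s =
    0.\<close>
  have w: "1 + k * s \<le> u x powr k" for k
    using ln_le_minus_one[of "u x powr k"] u_pos[of x] by (simp add: s_def)
  have "u x \<le> r x" by (simp add: r_def)
  then have "u x powr q \<le> r x powr q" using u_pos[of x] q_pos by (simp add: powr_mono2)
  then have "u x powr q / q - u x powr p / p \<le> 1 / q - 1 / p"
    using const H0 q_pos divide_right_mono[of "u x powr q" "r x powr q" q] by (simp add: H_def)
  moreover have "(1 + p * s) / p \<ge> u x powr p / p"
    using w[of p] p_neg by (simp add: divide_right_mono_neg)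
  moreover have "(1 + p * s) / p = 1 / p + s" "(1 + q * s) / q = 1 / q + s"
    using p_neg q_pos by (simp_all add: add_divide_distrib)
  ultimately have "u x powr q / q \<le> (1 + q * s) / q" by linarith
  then have "u x powr q = 1 + q * s" using w[of q] q_pos by (simp add: divide_le_cancel)
  moreover have "ln (u x powr q) = q * s" using u_pos[of x] by (simp add: s_def)
  ultimately have "ln (u x powr q) = u x powr q - 1" by linarith
  then have "u x powr q = 1" using ln_eq_minus_one[of "u x powr q"] u_pos[of x] by simp
  then show "u x = 1" using \<open>u x powr q = 1 + q * s\<close> q_pos u_pos[of x] by (simp add: s_def)
qed

lemma y'_periodic: "y' (x + 2 * pi) = y' x"
  by (simp add: y'_def t_def z_def r_def periodic y_periodic)

text \<open>The exponents \<open>c\<close> and \<open>d\<close> may differ, because all functions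
  \<open>f k c\<close> have the zeros and signs of u', so both length bounds concern the same nodal
  intervals.\<close>

lemma solution_eq_1:
  assumes lower: "\<And>x. Q 2 c x + 4 > 0" and upper: "\<And>x. Q 1 d x + 1 < 0"
  shows "u x = 1"
proof (rule ccontr)
  assume "u x \<noteq> 1"
  then have simple: "y' x0 \<noteq> 0" if "y x0 = 0" for x0
    using double_zero_imp_const that by blast
  \<comment> \<open>The factor \<open>\<sigma>\<close> treats positive and negative nodal intervals
    at once; the known zero \<open>w\<close> caps the next one.\<close>
  have next_node: "\<exists>b>a. y b = 0 \<and> \<sigma> * y' b < 0 \<and> pi / 2 < b - a \<and> b - a < pi \<and> b \<le> w"
    if \<sigma>: "\<sigma> \<noteq> 0" and a: "y a = 0" "\<sigma> * y' a > 0" and w: "a < w" "y w = 0" for \<sigma> a w :: real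
  proof -
    obtain b where b: "a < b" "y b = 0" "\<sigma> * y' b < 0"
      and pos: "\<And>x. a < x \<Longrightarrow> x < b \<Longrightarrow> \<sigma> * y x > 0"
      and least: "\<And>x. a < x \<Longrightarrow> y x = 0 \<Longrightarrow> b \<le> x"
    proof (rule next_zero[of "\<lambda>x. \<sigma> * y x" "\<lambda>x. \<sigma> * y' x" a w])
      show "((\<lambda>x. \<sigma> * y x) has_real_derivative \<sigma> * y' x) (at x)" for x
        by (intro DERIV_cmult dy')
    qed (use \<sigma> a w simple in auto)
    have dF: "((\<lambda>x. \<sigma> * f k c x) has_real_derivative \<sigma> * f' k c x) (at x)"
      and dF': "((\<lambda>x. \<sigma> * f' k c x) has_real_derivative \<sigma> * (f k c x * Q k c x)) (at x)" for k c x
      by (intro DERIV_cmult df df')+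
    have "2 * (b - a) > pi"
    proof (rule sturm_length_gt[OF b(1) _ dF dF'])
      fix x assume "a < x" "x < b"
      then have "\<sigma> * f 2 c x > 0" using pos f_sign by blast
      then have "\<sigma> * f 2 c x * (Q 2 c x + 4) > 0" using lower[of x] by simp
      then show "\<sigma> * (f 2 c x * Q 2 c x) + 2\<^sup>2 * (\<sigma> * f 2 c x) > 0"
        by (simp add: algebra_simps)
    qed (use a b pos in \<open>auto simp: f_zero f_sign\<close>)
    moreover have "1 * (b - a) < pi"
    proof (rule sturm_length_lt[OF _ dF dF'])
      fix x assume "a < x" "x < b"
      then have "\<sigma> * f 1 d x > 0" using pos f_sign by blast
      then have "\<sigma> * f 1 d x * (Q 1 d x + 1) < 0" using upper[of x] by (rule mult_pos_neg)
      then show "\<sigma> * (f 1 d x * Q 1 d x) + 1\<^sup>2 * (\<sigma> * f 1 d x) < 0"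
        by (simp add: algebra_simps)
    qed (use a b pos in \<open>auto simp: f_zero f_sign\<close>)
    ultimately show ?thesis using b least[OF w] by (intro exI[of _ b]) auto
  qed
  obtain a where "(u has_real_derivative 0) (at a)"
  proof (rule exE[OF Rolle[of 0 "2 * pi" u]])
    show "continuous_on {0..2 * pi} u"
      using du by (meson DERIV_isCont continuous_at_imp_continuous_on)
    show "u differentiable at x" for x
      using du real_differentiable_def by blast
  qed (use periodic[of 0] in auto)
  then have a: "y a = 0" using du DERIV_unique by blast
  define \<sigma> where "\<sigma> = y' a"
  have \<sigma>: "\<sigma> \<noteq> 0" "\<sigma> * y' a > 0" using simple[OF a] by (auto simp: \<sigma>_def zero_less_mult_iff)
  define w where "w = a + 2 * pi"
  have w: "y w = 0" "\<sigma> * y' w > 0" using a \<sigma> by (simp_all add: w_def y_periodic y'_periodic)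
  obtain x1 where x1: "x1 > a" "y x1 = 0" "\<sigma> * y' x1 < 0" "pi / 2 < x1 - a" "x1 - a < pi" "x1 \<le> w"
    using next_node[OF \<sigma>(1) a \<sigma>(2) _ w(1)] by (auto simp: w_def)
  \<comment> \<open>By periodicity \<open>y'\<close> has the same sign at \<open>w\<close> as at
    \<open>a\<close>, whereas it changes sign from each node to the next. So \<open>w\<close> cannot
    be an odd-numbered node.\<close>
  have "x1 < w" using x1 w by (cases "x1 = w") auto
  obtain x2 where x2: "x2 > x1" "y x2 = 0" "- \<sigma> * y' x2 < 0" "pi / 2 < x2 - x1" "x2 - x1 < pi"
    using next_node[of "- \<sigma>" x1, OF _ x1(2) _ \<open>x1 < w\<close> w(1)] \<sigma>(1) x1(3) by auto
  \<comment> \<open>Two gaps shorter than pi do not fill the period.\<close>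
  have "x2 < w" using x1(5) x2(5) by (simp add: w_def)
  obtain x3 where x3: "x3 > x2" "y x3 = 0" "\<sigma> * y' x3 < 0" "pi / 2 < x3 - x2" "x3 \<le> w"
    using next_node[OF \<sigma>(1) x2(2) _ \<open>x2 < w\<close> w(1)] x2(3) by auto
  have "x3 < w" using x3 w by (cases "x3 = w") auto
  obtain x4 where x4: "pi / 2 < x4 - x3" "x4 \<le> w"
    using next_node[of "- \<sigma>" x3, OF _ x3(2) _ \<open>x3 < w\<close> w(1)] \<sigma>(1) x3(3) by auto
  \<comment> \<open>Four gaps longer than pi/2 overshoot the period.\<close>
  show False using x1(4) x2(4) x3(4) x4 by (simp add: w_def)
qed

end

section \<open>Arithmetic of the two parameter ranges\<close>

text \<open>The last two bounds are conditions of \<open>Q_lower\<close> for c = q - 2. The linear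
  one replaces q^2 by its tangent at q = 2.\<close>

lemma parameter_bounds_q:
  fixes p q :: real
  assumes A: "q > 2" "p + 3 < q" "q \<le> 2 * sqrt ((5 + p) / 3)"
  shows "p < 0" "3 * q - 8 \<le> p" "0 \<le> q + p * (q - 1)"
proof -
  have "(5 + p) / 3 \<ge> 0" using A real_sqrt_ge_0_iff[of "(5 + p) / 3"] by linarith
  moreover have "q\<^sup>2 \<le> (2 * sqrt ((5 + p) / 3))\<^sup>2" using A by (intro power_mono) auto
  ultimately have q: "q\<^sup>2 * 3 \<le> 4 * (5 + p)" by (simp add: power_mult_distrib)
  have "(q - 2)\<^sup>2 \<ge> 0" by simp
  then show lin: "3 * q - 8 \<le> p" using q by (simp add: power2_eq_square algebra_simps)
  then show "p < 0" using A by linarith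
  \<comment> \<open>At the least \<open>p\<close> allowed by the squared hypothesis, four times the
    target is a cubic in \<open>q\<close> with root 2; the slack in \<open>p\<close> enters with
    factor q - 1.\<close>
  have "q * q > 2 * 2" using A by (intro mult_strict_mono) auto
  then have "(q - 2) * (3 * (q * q) + 3 * q - 10) \<ge> 0" using A by simp
  moreover have "(q - 1) * (4 * (5 + p) - q\<^sup>2 * 3) \<ge> 0" using A q by simp
  ultimately have "0 \<le> (q - 2) * (3 * (q * q) + 3 * q - 10) + (q - 1) * (4 * (5 + p) - q\<^sup>2 * 3)"
    by (rule add_nonneg_nonneg)
  also have "\<dots> = 4 * (q + p * (q - 1))"
    by (simp add: power2_eq_square algebra_simps)
  finally show "0 \<le> q + p * (q - 1)" by (simp only: zero_le_mult_iff) simp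
qed

text \<open>This range is the image of the other under (p, q) -> (-q, -p). The last bound is the
  constant term in \<open>Q_lower\<close> for c = (q - 2) / 3, up to a factor 3.\<close>

lemma parameter_bounds_p:
  fixes p q :: real
  assumes A: "p < - 2" "- 2 * sqrt ((5 - q) / 3) \<le> p" "p < q - 3"
  shows "0 < q" "q - p < 4" "0 \<le> 4 + p + q + p * q"
proof -
  have "(5 - q) / 3 \<ge> 0" using A real_sqrt_ge_0_iff[of "(5 - q) / 3"] by linarith
  moreover have "(- p)\<^sup>2 \<le> (2 * sqrt ((5 - q) / 3))\<^sup>2" using A by (intro power_mono) auto
  ultimately have p: "p\<^sup>2 * 3 \<le> 4 * (5 - q)" by (simp add: power_mult_distrib)
  have "(p + 2)\<^sup>2 \<ge> 0" by simp
  then have lin: "q \<le> 8 + 3 * p" using p by (simp add: power2_eq_square algebra_simps)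
  then show "0 < q" "q - p < 4" using A by linarith+
  \<comment> \<open>The target decreases in \<open>q\<close>. At the greatest \<open>q\<close>
    allowed, four times it is a cubic in \<open>p\<close> with the double root -2.\<close>
  have "(- 1 - p) * (4 * (5 - q) - p\<^sup>2 * 3) \<ge> 0" using A p by simp
  moreover have "(p + 2)\<^sup>2 * (9 - 3 * p) \<ge> 0" using A by simp
  ultimately have "0 \<le> (- 1 - p) * (4 * (5 - q) - p\<^sup>2 * 3) + (p + 2)\<^sup>2 * (9 - 3 * p)"
    by (rule add_nonneg_nonneg)
  also have "\<dots> = 4 * (4 + p + q + p * q)"
    by (simp add: power2_eq_square algebra_simps)
  finally show "0 \<le> 4 + p + q + p * q" by (simp only: zero_le_mult_iff) simp
qed

context periodic_solution
begin

lemma solution_eq_1_q: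
  assumes "q > 2" "p + 3 < q" "q \<le> 2 * sqrt ((5 + p) / 3)"
  shows "u x = 1"
proof (rule solution_eq_1)
  note b = parameter_bounds_q[OF assms]
  \<comment> \<open>This exponent removes the z-slope in the coefficient of t^2. Below, exponent 0
    makes \<open>f\<close> equal to u' itself.\<close>
  show "Q 2 (q - 2) x + 4 > 0" for x
    using assms(1) b by (intro Q_lower) (auto simp: algebra_simps)
  show "Q 1 0 x + 1 < 0" for x
    using assms p_neg by (intro Q_upper) auto
qed

lemma solution_eq_1_p:
  assumes "p < - 2" "- 2 * sqrt ((5 - q) / 3) \<le> p" "p < q - 3"
  shows "u x = 1"
proof (rule solution_eq_1)
  note b = parameter_bounds_p[OF assms]
  \<comment> \<open>This exponent removes the slope 3c + 2 - q of the part free of t.\<close>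
  show "Q 2 ((q - 2) / 3) x + 4 > 0" for x
  proof (rule Q_lower)
    have "((q - 2) / 3 + 1) * ((q - 2) / 3 + 2 - q) = (q + 1) * (4 - 2 * q) / 9"
      by (simp add: field_simps)
    moreover have "0 \<le> (q + 1) * (4 - 2 * q) / 9" using assms b by simp
    ultimately show "0 \<le> ((q - 2) / 3 + 1) * ((q - 2) / 3 + 2 - q)" by metis
  qed (use b in \<open>auto simp: field_simps\<close>)
  \<comment> \<open>Now \<open>f\<close> is u'/r, and the t^2 part of Q + 1 vanishes through its
    factor c + 1.\<close>
  show "Q 1 (- 1) x + 1 < 0" for x
    using assms q_pos by (intro Q_upper) auto
qed

end

section \<open>The unit circle as a solution\<close>

lemma norm_unit_normal [simp]: "norm (unit_normal \<theta>) = 1"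
  by (simp add: unit_normal_def norm_vec_def L2_set_def sum_2)

lemma unit_normal_periodic [simp]: "unit_normal (\<theta> + 2 * pi) = unit_normal \<theta>"
  by (simp add: unit_normal_def)

lemma ex_unit_normal:
  assumes "norm (x :: real^2) = 1"
  obtains \<theta> where "0 \<le> \<theta>" "\<theta> < 2 * pi" "x = unit_normal \<theta>"
proof -
  have "(x $ 1)\<^sup>2 + (x $ 2)\<^sup>2 = 1"
    using assms by (simp add: norm_vec_def L2_set_def sum_2)
  from sincos_total_2pi[OF this] obtain \<theta> where
    "0 \<le> \<theta>" "\<theta> < 2 * pi" "x $ 1 = cos \<theta>" "x $ 2 = sin \<theta>" by metis
  then show thesis by (intro that[of \<theta>]) (auto simp: unit_normal_def vec_eq_iff forall_2)
qed

text \<open>Writing the derivative as a quarter-turn shift lets all higher derivatives follow by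
  induction on the shift.\<close>

lemma unit_normal_has_vector_derivative:
  "((\<lambda>s. unit_normal (s + a)) has_vector_derivative unit_normal (t + (a + pi / 2))) (at t)"
proof -
  have eq: "unit_normal s = cos s *\<^sub>R axis 1 1 + sin s *\<^sub>R axis 2 1" for s
    by (auto simp: unit_normal_def vec_eq_iff forall_2 axis_def)
  have "((\<lambda>s. cos (s + a) *\<^sub>R axis 1 1 + sin (s + a) *\<^sub>R axis 2 1 :: real^2) has_vector_derivative
      (- sin (t + a)) *\<^sub>R axis 1 1 + cos (t + a) *\<^sub>R axis 2 1) (at t)"
    by (auto intro!: derivative_eq_intros)
  moreover have "cos (t + (a + pi / 2)) = - sin (t + a)" "sin (t + (a + pi / 2)) = cos (t + a)"
    by (simp_all add: cos_add sin_add)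
  ultimately show ?thesis unfolding eq by simp
qed

lemma velocity_unit_normal:
  "velocity (\<lambda>s. unit_normal (s + a)) = (\<lambda>s. unit_normal (s + (a + pi / 2)))"
  unfolding velocity_def
  by (intro ext vector_derivative_at unit_normal_has_vector_derivative)

lemma smooth_unit_normal: "smooth unit_normal"
proof -
  have "((\<lambda>g s. vector_derivative g (at s)) ^^ k) unit_normal
        = (\<lambda>s. unit_normal (s + real k * (pi / 2)))" for k
  proof (induction k)
    case (Suc k)
    have "real k * (pi / 2) + pi / 2 = real (Suc k) * (pi / 2)" by (simp add: algebra_simps)
    then show ?case
      using velocity_unit_normal[of "real k * (pi / 2)"]
      by (simp only: funpow.simps o_apply Suc.IH) (simp add: velocity_def fun_eq_iff)
  qed simp
  then show ?thesis
    unfolding smooth_def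
    using unit_normal_has_vector_derivative has_vector_derivative_def differentiable_def by metis
qed

lemma smooth_closed_embedded_positively_curved_circle:
  "smooth_closed_embedded_positively_curved (sphere 0 1)"
  unfolding smooth_closed_embedded_positively_curved_def
proof (intro exI[of _ unit_normal] conjI allI)
  show "inj_on unit_normal {0..<2 * pi}"
  proof (rule inj_onI)
    fix x y assume xy: "x \<in> {0..<2 * pi}" "y \<in> {0..<2 * pi}" "unit_normal x = unit_normal y"
    then have "sin x = sin y \<and> cos x = cos y"
      by (simp add: unit_normal_def vec_eq_iff forall_2)
    then obtain n where n: "x = y + 2 * pi * real_of_int n"
      using sin_cos_eq_iff by metis
    then have "\<bar>2 * pi * real_of_int n\<bar> < 2 * pi * 1" using xy(1,2) by auto
    then have "\<bar>real_of_int n\<bar> < 1" by (simp add: abs_mult)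
    then have "n = 0" by linarith
    with n show "x = y" by simp
  qed
  show "range unit_normal = sphere 0 1"
    using ex_unit_normal by (force simp: sphere_def dist_norm)
  have v: "velocity unit_normal = (\<lambda>s. unit_normal (s + pi / 2))"
    using velocity_unit_normal[of 0] by simp
  show "velocity unit_normal t \<noteq> 0" for t
    using norm_unit_normal[of "t + pi / 2"] by (auto simp: v simp del: norm_unit_normal)
  have vv: "velocity (\<lambda>s. unit_normal (s + pi / 2)) t = unit_normal (t + pi)" for t
    using velocity_unit_normal[of "pi / 2"] by simp
  have "curvature unit_normal t = (sin t)\<^sup>2 + (cos t)\<^sup>2" for t
    unfolding curvature_def v vv norm_unit_normal
    by (simp add: unit_normal_def cos_add sin_add power2_eq_square)
  then show "curvature unit_normal t > 0" for t by simp
qed (simp_all add: smooth_unit_normal)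

lemma support_function_unit_disc: "support_function (cball 0 1) = (\<lambda>_. 1)"
proof
  fix \<theta>
  show "support_function (cball 0 1) \<theta> = 1"
    unfolding support_function_def
  proof (rule cSup_eq_maximum)
    show "1 \<in> (\<lambda>x. x \<bullet> unit_normal \<theta>) ` cball 0 1"
      by (rule image_eqI[of _ _ "unit_normal \<theta>"]) (simp_all add: dot_square_norm)
    show "y \<le> 1" if "y \<in> (\<lambda>x. x \<bullet> unit_normal \<theta>) ` cball 0 1" for y
    proof -
      from that obtain x where "norm x \<le> 1" "y = x \<bullet> unit_normal \<theta>" by auto
      then show ?thesis using norm_cauchy_schwarz[of x "unit_normal \<theta>"] by simp
    qed
  qed
qed

lemma embedded_solution_unit_circle: "embedded_solution p q (sphere 0 1)"
  unfolding embedded_solution_def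
proof (intro conjI exI[of _ "cball 0 1 :: (real^2) set"] smooth_closed_embedded_positively_curved_circle)
  show "strictly_convex (cball 0 1 :: (real^2) set)"
    \<comment> \<open>Every point of an open segment is strictly closer to the centre than one of
      the endpoints.\<close>
    unfolding strictly_convex_def
    using dist_decreases_open_segment[of _ _ _ 0] by (fastforce simp: dist_norm)
  have "((\<lambda>g s. vector_derivative g (at s)) ^^ k) (\<lambda>_. 1 :: real) = (\<lambda>_. if k = 0 then 1 else 0)" for k
    by (induction k) simp_all
  then show "smooth (support_function (cball 0 1))"
    by (simp add: support_function_unit_disc smooth_def)
  show "isotropic_Lp_dual_Minkowski p q (support_function (cball 0 1))"
    by (simp add: support_function_unit_disc isotropic_Lp_dual_Minkowski_def radial_distance_def)
qed (simp_all add: support_function_unit_disc)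

section \<open>From the support function back to the body and its boundary\<close>

text \<open>Testing a point of \<open>K\<close> in its own direction bounds its norm by 1.
  Conversely, a point of the disc outside \<open>K\<close> could be strictly separated from
  \<open>K\<close>, giving support value below 1 in some direction.\<close>

lemma support_function_eq_1_imp_unit_disc:
  assumes K: "compact K" "convex K" "K \<noteq> {}" and s: "\<And>\<theta>. support_function K \<theta> = 1"
  shows "K = cball 0 1"
proof
  have bdd: "bdd_above ((\<lambda>x. x \<bullet> unit_normal \<theta>) ` K)" for \<theta>
    using K(1) by (intro bounded_imp_bdd_above compact_imp_bounded compact_continuous_image continuous_intros)
  have le: "x \<bullet> unit_normal \<theta> \<le> 1" if "x \<in> K" for x \<theta>
    using cSUP_upper[OF that bdd] s by (simp add: support_function_def)
  show "K \<subseteq> cball 0 1"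
  proof
    fix x assume x: "x \<in> K"
    show "x \<in> cball 0 1"
    proof (cases "x = 0")
      case False
      then have "norm (x /\<^sub>R norm x) = 1" by simp
      then obtain \<theta> where "x /\<^sub>R norm x = unit_normal \<theta>" by (rule ex_unit_normal)
      with le[OF x, of \<theta>] have "x \<bullet> (x /\<^sub>R norm x) \<le> 1" by simp
      then show ?thesis using False by (simp add: dot_square_norm power2_eq_square field_simps)
    qed simp
  qed
  show "cball 0 1 \<subseteq> K"
  proof (rule ccontr)
    assume "\<not> cball 0 1 \<subseteq> K"
    then obtain v where v: "v \<notin> K" and "v \<in> cball 0 1" by blast
    then have "norm v \<le> 1" by simp
    obtain a b where ab: "a \<bullet> v < b" "\<And>x. x \<in> K \<Longrightarrow> a \<bullet> x > b"
      using separating_hyperplane_closed_point[of K v] K(1,2) v compact_imp_closed by metis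
    then have "a \<noteq> 0" using K(3) by force
    then have "norm (- a /\<^sub>R norm a) = 1" by simp
    \<comment> \<open>The sign is reversed because \<open>a\<close> points from \<open>v\<close>
      towards \<open>K\<close>.\<close>
    then obtain \<theta> where \<theta>: "- a /\<^sub>R norm a = unit_normal \<theta>" by (rule ex_unit_normal)
    have "x \<bullet> unit_normal \<theta> \<le> - b / norm a" if "x \<in> K" for x
      using ab(2)[OF that] \<open>a \<noteq> 0\<close> by (simp flip: \<theta> add: inner_commute field_simps)
    then have "support_function K \<theta> \<le> - b / norm a"
      unfolding support_function_def using K(3) by (intro cSUP_least)
    also have "\<dots> < v \<bullet> unit_normal \<theta>"
      using ab(1) \<open>a \<noteq> 0\<close> by (simp flip: \<theta> add: inner_commute field_simps)
    also have "\<dots> \<le> 1" using norm_cauchy_schwarz[of v "unit_normal \<theta>"] \<open>norm v \<le> 1\<close> by simp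
    finally show False using s by simp
  qed
qed

lemma smooth_real_derivs:
  fixes u :: "real \<Rightarrow> real"
  assumes "smooth u"
  shows "(u has_real_derivative deriv u x) (at x)"
    and "(deriv u has_real_derivative deriv (deriv u) x) (at x)"
proof -
  \<comment> \<open>Smoothness is stated with \<open>vector_derivative\<close>, the equation with
    \<open>deriv\<close>; this identifies them.\<close>
  have D: "vector_derivative g (at s) = deriv g s" if "g differentiable at s" for g :: "real \<Rightarrow> real" and s
    using that by (simp add: deriv_def vector_derivative_def has_real_derivative_iff_has_vector_derivative)
  have d0: "u differentiable at s" for s
    using assms[unfolded smooth_def, rule_format, of 0 s] by simp
  have d1: "deriv u differentiable at s" for s
    using assms[unfolded smooth_def, rule_format, of 1 s] D[OF d0] by simp
  show "(u has_real_derivative deriv u x) (at x)"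
    "(deriv u has_real_derivative deriv (deriv u) x) (at x)"
    using d0[of x] d1[of x] by (auto simp: real_differentiable_def DERIV_imp_deriv)
qed

theorem corollary1p8:
  fixes p q :: real
  assumes "(q > 2 \<and> p + 3 < q \<and> q \<le> 2 * sqrt ((5 + p) / 3)) \<or>
           (p < -2 \<and> - 2 * sqrt ((5 - q) / 3) \<le> p \<and> p < q - 3)"
  shows "\<exists>!M. embedded_solution p q M"
proof (rule ex1I)
  show "embedded_solution p q (sphere 0 1)"
    by (rule embedded_solution_unit_circle)
next
  fix M assume "embedded_solution p q M"
  then obtain K where K: "compact K" "convex K" "0 \<in> interior K" "frontier K = M"
    and sm: "smooth (support_function K)" and pos: "\<And>\<theta>. support_function K \<theta> > 0"
    and eq: "isotropic_Lp_dual_Minkowski p q (support_function K)"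
    unfolding embedded_solution_def by blast
  define u where "u = support_function K"
  note d = smooth_real_derivs[OF sm, folded u_def]
  \<comment> \<open>Positivity of u and r permits solving the equation for u'', as the locale
    requires.\<close>
  have "deriv (deriv u) x = u x powr (p - 1) * radial_distance u x powr (2 - q) - u x" for x
  proof -
    have r: "radial_distance u x > 0" "u x > 0"
      using pos[of x] by (simp_all add: radial_distance_def u_def sum_power2_gt_zero_iff)
    have "u x powr (1 - p) * radial_distance u x powr (q - 2) * (deriv (deriv u) x + u x) = 1"
      using eq by (simp add: isotropic_Lp_dual_Minkowski_def u_def)
    moreover have "u x powr (1 - p) = inverse (u x powr (p - 1))"
      "radial_distance u x powr (q - 2) = inverse (radial_distance u x powr (2 - q))"
      by (simp_all flip: powr_minus)
    ultimately show ?thesis using r by (simp add: field_simps)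
  qed
  then have "(deriv u has_real_derivative u x powr (p - 1) *
      sqrt ((u x)\<^sup>2 + (deriv u x)\<^sup>2) powr (2 - q) - u x) (at x)" for x
    using d(2)[of x] by (simp add: radial_distance_def)
  moreover have "p < 0" "q > 0"
    using assms parameter_bounds_q[of q p] parameter_bounds_p[of p q] by auto
  moreover have "u (x + 2 * pi) = u x" for x by (simp add: u_def support_function_def)
  ultimately interpret periodic_solution p q u "deriv u"
    using d(1) pos by unfold_locales (auto simp: u_def)
  have "support_function K \<theta> = 1" for \<theta>
    using assms solution_eq_1_q solution_eq_1_p unfolding u_def by blast
  then have "K = cball 0 1"
    using K interior_subset by (intro support_function_eq_1_imp_unit_disc) auto
  then show "M = sphere 0 1" using K(4) by simp
qed

end
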